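(* Let $A$ be a set with $|A|\ge 2$ and let $\mathcal C$ be a multiclone on $A$ with $\mathcal C\neq\mathcal Q$. Then $\mathcal C\setminus\mathcal Q$ contains at least one of the following: (1) a unary multioperation; (2) a binary idempotent multioperation; (3) a majority multioperation; (4) a semiprojection; (5) the multioperation $(x,y,z)\mapsto\{x+y+z\}$, where $+$ is the operation of some Boolean group $\langle A;+,0\rangle$ on $A$.
   Context: For $n\ge 1$, an $n$-ary multioperation on $A$ is a map $f:A^n\to\mathfrak P(A)$, where $\mathfrak P(A)$ is the set of all subsets of $A$. The empty set is allowed as a value. Let $\mathcal M^{(n)}$ be the set of $n$-ary multioperations and $\mathcal M=\bigcup_{n\ge1}\mathcal M^{(n)}$. For $\mathcal C\subseteq\mathcal M$, write $\mathcal C^{(n)}=\mathcal C\cap\mathcal M^{(n)}$. An ordinary operation $g:A^n\to A$ is identified with the multioperation $a\mapsto\{g(a)\}$. The projections are $e^n_i(x_1,\dots,x_n)=\{x_i\}$ for $1\le i\le n$, and $\mathcal Q$ denotes the set of all projections (of all arities). Composition: for $f\in\mathcal M^{(i)}$ and $g_1,\dots,g_i\in\mathcal M^{(j)}$, the multioperation $f(g_1,\dots,g_i)\in\mathcal M^{(j)}$ is defined by $$f(g_1,\dots,g_i)(a)=\bigcup\{f(u_1,\dots,u_i): u_1\in g_1(a),\dots,u_i\in g_i(a)\}\quad\text{for } a\in A^j.$$ A multiclone on $A$ is a subset of $\mathcal M$ that contains $\mathcal Q$ and is closed under all such compositions. A multioperation $f$ is idempotent if $f(x,\dots,x)=\{x\}$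 for all $x\in A$. A ternary $f$ is a majority multioperation if $f(x,x,y)=f(x,y,x)=f(y,x,x)=\{x\}$ for all $x,y\in A$. For $n\ge3$ and $1\le i\le n$, an $f\in\mathcal M^{(n)}$ is a semiprojection (on its $i$-th coordinate) if $f(a_1,\dots,a_n)=\{a_i\}$ whenever $a_1,\dots,a_n\in A$ are not pairwise distinct. A Boolean group is a group $\langle A;+,0\rangle$ satisfying $a+a=0$ for all $a\in A$. *)

theory Defs
  imports "HOL-Algebra.Group"
begin

text \<open>Tuples are lists. A multioperation is a pair of its arity and an extensional
  function; since a multioperation may take the empty set as a value, the arity
  is kept explicitly, so that distinct arities are disjoint.\<close>

definition tuples :: "'a set \<Rightarrow> nat \<Rightarrow> 'a list set" where
  "tuples A n = {xs. length xs = n \<and> set xs \<subseteq> A}"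

type_synonym 'a multiop = "nat \<times> ('a list \<Rightarrow> 'a set)"

definition multiops :: "'a set \<Rightarrow> 'a multiop set" where
  "multiops A = (SIGMA n:{1..}. tuples A n \<rightarrow>\<^sub>E Pow A)"

definition of_op :: "'a set \<Rightarrow> nat \<Rightarrow> ('a list \<Rightarrow> 'a) \<Rightarrow> 'a multiop" where
  "of_op A n g = (n, \<lambda>a\<in>tuples A n. {g a})"

text \<open>Coordinates are numbered from 0.\<close>

definition projections :: "'a set \<Rightarrow> 'a multiop set" where
  "projections A = {of_op A n (\<lambda>a. a ! i) | n i. i < n}"

text \<open>\<open>listset [U\<^sub>1, \<dots>, U\<^sub>i]\<close> is the set of lists \<open>[u\<^sub>1, \<dots>, u\<^sub>i]\<close> with \<open>u\<^sub>k \<in> U\<^sub>k\<close> for all \<open>k\<close>.\<close>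

definition multicomp ::
  "'a set \<Rightarrow> nat \<Rightarrow> ('a list \<Rightarrow> 'a set) \<Rightarrow> ('a list \<Rightarrow> 'a set) list \<Rightarrow> 'a multiop" where
  "multicomp A j f gs = (j, \<lambda>a\<in>tuples A j. \<Union>us\<in>listset (map (\<lambda>g. g a) gs). f us)"

definition multiclone :: "'a set \<Rightarrow> 'a multiop set \<Rightarrow> bool" where
  "multiclone A C \<longleftrightarrow>
     C \<subseteq> multiops A \<and> projections A \<subseteq> C \<and>
     (\<forall>i j f gs. (i, f) \<in> C \<longrightarrow> length gs = i \<longrightarrow> (\<forall>g\<in>set gs. (j, g) \<in> C) \<longrightarrow>
        multicomp A j f gs \<in> C)"

definition idempotent_multiop :: "'a set \<Rightarrow> 'a multiop \<Rightarrow> bool" where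
  "idempotent_multiop A = (\<lambda>(n, f). \<forall>x\<in>A. f (replicate n x) = {x})"

definition majority :: "'a set \<Rightarrow> 'a multiop \<Rightarrow> bool" where
  "majority A = (\<lambda>(n, f). n = 3 \<and>
     (\<forall>x\<in>A. \<forall>y\<in>A. f [x, x, y] = {x} \<and> f [x, y, x] = {x} \<and> f [y, x, x] = {x}))"

definition semiprojection :: "'a set \<Rightarrow> 'a multiop \<Rightarrow> bool" where
  "semiprojection A = (\<lambda>(n, f). n \<ge> 3 \<and>
     (\<exists>i<n. \<forall>a\<in>tuples A n. \<not> distinct a \<longrightarrow> f a = {a ! i}))"

definition boolean_group :: "('a, 'b) monoid_scheme \<Rightarrow> bool" where
  "boolean_group G \<longleftrightarrow> group G \<and> (\<forall>a\<in>carrier G. a \<otimes>\<^bsub>G\<^esub> a = \<one>\<^bsub>G\<^esub>)"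

end

theory Submission
  imports Defs
begin

text \<open>Take a non-projection \<open>f\<close> of minimal arity \<open>n\<close> in the multiclone; only \<open>n \<ge> 3\<close> needs work.
  By minimality, \<open>f\<close> becomes a projection when two of its variables are identified. If
  \<open>n \<ge> 4\<close>, comparing these projections on two-valued tuples shows that they all
  select the same coordinate, as in Swierczkowski's lemma, so \<open>f\<close> is a semiprojection. If
  \<open>n = 3\<close>, then \<open>f\<close> is a semiprojection, a majority, a minority, or of Pixley type, and in the
  last case substituting \<open>f\<close> into itself gives a majority. Let \<open>f\<close> be a minority and suppose
  that there are no semiprojections besides projections. As
  \<open>f(x, y, f(x, y, z))\<close> is a semiprojection, it equals \<open>z\<close>, which forces \<open>f\<close> to be
  single-valued. Symmetry of \<open>f\<close> and the identity \<open>f(x, u, f(y, u, z)) = f(x, y, z)\<close> follow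
  in the same way, and these make \<open>x + y = f(x, 0, y)\<close> a Boolean group operation.\<close>

section \<open>Tuples, projections and closure of multiclones\<close>

lemma listset_singletons: "listset (map (\<lambda>x. {h x}) xs) = {map h xs}"
  by (induction xs) (auto simp: set_Cons_def)

lemma tuples_nth: "a \<in> tuples A n \<Longrightarrow> i < n \<Longrightarrow> a ! i \<in> A"
  by (auto simp: tuples_def)

lemma map_upt_in_tuples:
  assumes "\<And>k. k < n \<Longrightarrow> h k \<in> A"
  shows "map h [0..<n] \<in> tuples A n"
  using assms by (auto simp: tuples_def)

lemma tuples_three:
  "a \<in> tuples A 3 \<longleftrightarrow> (\<exists>x\<in>A. \<exists>y\<in>A. \<exists>z\<in>A. a = [x, y, z])"
  by (auto simp: tuples_def length_Suc_conv numeral_3_eq_3)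

lemma tuples_four:
  "a \<in> tuples A 4 \<longleftrightarrow> (\<exists>x\<in>A. \<exists>y\<in>A. \<exists>z\<in>A. \<exists>u\<in>A. a = [x, y, z, u])"
  by (auto simp: tuples_def length_Suc_conv eval_nat_numeral)

text \<open>Members of \<open>multiops A\<close> are extensional, so the values on
  \<open>tuples A n\<close> determine them.\<close>

lemma projection_mem_iff:
  assumes "C \<subseteq> multiops A" and "(n, f) \<in> C"
  shows "(n, f) \<in> projections A \<longleftrightarrow> (\<exists>i<n. \<forall>a\<in>tuples A n. f a = {a ! i})"
proof
  assume "(n, f) \<in> projections A"
  then show "\<exists>i<n. \<forall>a\<in>tuples A n. f a = {a ! i}"
    by (auto simp: projections_def of_op_def)
next
  assume "\<exists>i<n. \<forall>a\<in>tuples A n. f a = {a ! i}"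
  then obtain i where i: "i < n" "\<forall>a\<in>tuples A n. f a = {a ! i}" by blast
  have "f \<in> extensional (tuples A n)"
    using assms by (auto simp: multiops_def PiE_def)
  then have "f = (\<lambda>a\<in>tuples A n. {a ! i})"
    using i(2) by (intro extensionalityI[where A = "tuples A n"]) auto
  then show "(n, f) \<in> projections A"
    using i(1) by (auto simp: projections_def of_op_def)
qed

lemma multiclone_comp:
  assumes "multiclone A C" and "(i, f) \<in> C" and "length gs = i" and "\<forall>g\<in>set gs. (j, g) \<in> C"
  shows "(j, \<lambda>a\<in>tuples A j. \<Union>us\<in>listset (map (\<lambda>g. g a) gs). f us) \<in> C"
  using assms unfolding multiclone_def multicomp_def by blast

lemma multiclone_projection:
  assumes "multiclone A C" and "i < n"
  shows "(n, \<lambda>a\<in>tuples A n. {a ! i}) \<in> C"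
  using assms unfolding multiclone_def projections_def of_op_def by blast

text \<open>Composing with projections gives every minor of \<open>f\<close>: variables may be
  identified, permuted or added as dummies. The inner values are singletons, so the union
  disappears.\<close>

lemma multiclone_subst_vars:
  assumes "multiclone A C" and "(n, f) \<in> C" and "\<And>k. k < n \<Longrightarrow> s k < m"
  shows "(m, \<lambda>b\<in>tuples A m. f (map (\<lambda>k. b ! s k) [0..<n])) \<in> C"
proof -
  define gs where "gs = map (\<lambda>k. \<lambda>b\<in>tuples A m. {b ! s k}) [0..<n]"
  have "(m, \<lambda>b\<in>tuples A m. \<Union>us\<in>listset (map (\<lambda>g. g b) gs). f us) \<in> C"
    by (rule multiclone_comp[OF assms(1,2)])
      (auto simp: gs_def intro!: multiclone_projection[OF assms(1)] assms(3))
  moreover have "(\<lambda>b\<in>tuples A m. \<Union>us\<in>listset (map (\<lambda>g. g b) gs). f us)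
      = (\<lambda>b\<in>tuples A m. f (map (\<lambda>k. b ! s k) [0..<n]))"
    by (rule restrict_ext) (simp add: gs_def comp_def listset_singletons)
  ultimately show ?thesis by simp
qed

lemma multiclone_comp3:
  assumes "multiclone A C" and "(3, f) \<in> C" and "(j, g) \<in> C" and "(j, h) \<in> C" and "(j, k) \<in> C"
  shows "(j, \<lambda>a\<in>tuples A j. \<Union>u\<in>g a. \<Union>v\<in>h a. \<Union>w\<in>k a. f [u, v, w]) \<in> C"
proof -
  have "(j, \<lambda>a\<in>tuples A j. \<Union>us\<in>listset (map (\<lambda>g. g a) [g, h, k]). f us) \<in> C"
    by (rule multiclone_comp[OF assms(1,2)]) (use assms in auto)
  moreover have "(\<Union>us\<in>listset (map (\<lambda>g. g a) [g, h, k]). f us)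
      = (\<Union>u\<in>g a. \<Union>v\<in>h a. \<Union>w\<in>k a. f [u, v, w])" for a
    by (auto simp: set_Cons_def) blast+
  ultimately show ?thesis by simp
qed

text \<open>The terms iterated in the minority case have this shape: variables in the first two
  places and a nested term in the third.\<close>

lemma multiclone_comp3_third:
  assumes "multiclone A C" and "(3, f) \<in> C" and "p < j" and "q < j" and "(j, g) \<in> C"
  shows "(j, \<lambda>a\<in>tuples A j. \<Union>w\<in>g a. f [a ! p, a ! q, w]) \<in> C"
proof -
  have "(\<lambda>a\<in>tuples A j. \<Union>u\<in>(\<lambda>a\<in>tuples A j. {a ! p}) a. \<Union>v\<in>(\<lambda>a\<in>tuples A j. {a ! q}) a.
      \<Union>w\<in>g a. f [u, v, w]) = (\<lambda>a\<in>tuples A j. \<Union>w\<in>g a. f [a ! p, a ! q, w])"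
    by (rule restrict_ext) simp
  then show ?thesis
    using multiclone_comp3[OF assms(1,2) multiclone_projection[OF assms(1,3)]
        multiclone_projection[OF assms(1,4)] assms(5)] by simp
qed

section \<open>Identification of variables\<close>

text \<open>States at arity \<open>n\<close> that the minor of \<open>f\<close> identifying
  variables \<open>i\<close> and \<open>j\<close> is a projection. The coordinate \<open>k\<close>
  need not be unique: \<open>i\<close> and \<open>j\<close> are interchangeable as its
  value.\<close>

definition collapses :: "'a set \<Rightarrow> nat \<Rightarrow> ('a list \<Rightarrow> 'a set) \<Rightarrow> nat \<Rightarrow> nat \<Rightarrow> nat \<Rightarrow> bool" where
  "collapses A n f i j k \<longleftrightarrow> k < n \<and> (\<forall>a\<in>tuples A n. a ! i = a ! j \<longrightarrow> f a = {a ! k})"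

lemma collapses_commute: "collapses A n f i j k \<Longrightarrow> collapses A n f j i k"
  by (auto simp: collapses_def)

lemma collapses_if_lower_arity_projections:
  assumes C: "multiclone A C" and f: "(n, f) \<in> C"
    and low: "\<And>g. (n - 1, g) \<in> C \<Longrightarrow> (n - 1, g) \<in> projections A"
    and ij: "i < j" "j < n"
  shows "\<exists>k. collapses A n f i j k"
proof -
  \<comment> \<open>\<open>s\<close> drops coordinate \<open>j\<close> and reads coordinate
    \<open>i\<close> in its place; \<open>t\<close> embeds the remaining \<open>n - 1\<close>
    coordinates by skipping \<open>j\<close>. Thus \<open>t (s k) = k\<close> except that
    \<open>t (s j) = i\<close>, which does no harm when \<open>a ! i = a ! j\<close>.\<close>
  define s where "s k = (if k < j then k else if k = j then i else k - 1)" for k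
  define t where "t k = (if k < j then k else k + 1)" for k
  have s: "s k < n - 1" if "k < n" for k using ij that by (auto simp: s_def)
  have t: "t k < n" if "k < n - 1" for k using ij that by (auto simp: t_def)
  define g where "g = (\<lambda>b\<in>tuples A (n - 1). f (map (\<lambda>k. b ! s k) [0..<n]))"
  have gC: "(n - 1, g) \<in> C"
    unfolding g_def by (rule multiclone_subst_vars[OF C f s])
  then have "\<exists>p<n - 1. \<forall>b\<in>tuples A (n - 1). g b = {b ! p}"
    using low projection_mem_iff[OF _ gC] C unfolding multiclone_def by blast
  then obtain p where p: "p < n - 1" "\<And>b. b \<in> tuples A (n - 1) \<Longrightarrow> g b = {b ! p}" by blast
  have "f a = {a ! t p}" if a: "a \<in> tuples A n" "a ! i = a ! j" for a
  proof -
    define b where "b = map (\<lambda>k. a ! t k) [0..<n - 1]"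
    have b: "b \<in> tuples A (n - 1)"
      unfolding b_def by (rule map_upt_in_tuples) (use a t in \<open>auto intro: tuples_nth\<close>)
    have "b ! s k = a ! k" if "k < n" for k
    proof -
      have "b ! s k = a ! t (s k)" using s[OF that] by (simp add: b_def)
      also have "\<dots> = a ! k" using a(2) ij by (auto simp: s_def t_def)
      finally show ?thesis .
    qed
    then have "map (\<lambda>k. b ! s k) [0..<n] = a"
      using a(1) by (intro nth_equalityI) (auto simp: tuples_def)
    then have "f a = g b" using b by (simp add: g_def)
    then show ?thesis using p b by (simp add: b_def)
  qed
  then show ?thesis using t[OF p(1)] unfolding collapses_def by blast
qed

text \<open>Swierczkowski's lemma; the tuples that take the value \<open>x\<close> on a set \<open>S\<close> of coordinates and \<open>y\<close>
  elsewhere suffice to compare the coordinates selected by two identifications.\<close>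

lemma semiprojection_if_collapses:
  assumes xy: "x \<in> A" "y \<in> A" "x \<noteq> y" and n: "n \<ge> 4"
    and col: "\<And>i j. i < j \<Longrightarrow> j < n \<Longrightarrow> \<exists>k. collapses A n f i j k"
  shows "semiprojection A (n, f)"
proof -
  define P where "P = collapses A n f"
  define T where "T S = map (\<lambda>k. if k \<in> S then x else y) [0..<n]" for S
  have T: "T S \<in> tuples A n" for S
    unfolding T_def by (rule map_upt_in_tuples) (use xy in auto)
  have ex: "\<exists>k. P i j k" if "i < n" "j < n" "i \<noteq> j" for i j
    using col[of i j] col[of j i] that collapses_commute unfolding P_def
    by (metis linorder_neqE_nat)
  \<comment> \<open>If \<open>S\<close> separates neither pair, both identifications apply to
    \<open>T S\<close>, so the two selected coordinates carry the same one of the values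
    \<open>x\<close> and \<open>y\<close>.\<close>
  have compare: "k \<in> S \<longleftrightarrow> k' \<in> S"
    if "P i j k" "P i' j' k'" "i < n" "j < n" "i' < n" "j' < n"
      "i \<in> S \<longleftrightarrow> j \<in> S" "i' \<in> S \<longleftrightarrow> j' \<in> S" for i j k i' j' k' S
  proof -
    have lt: "k < n" "k' < n" using that by (auto simp: P_def collapses_def)
    have "f (T S) = {T S ! k}" "f (T S) = {T S ! k'}"
      using that T[of S] by (auto simp: P_def collapses_def T_def)
    then have "T S ! k = T S ! k'" by simp
    then show ?thesis using lt xy(3) by (auto simp: T_def split: if_splits)
  qed
  \<comment> \<open>Otherwise every identification selects a coordinate of its own pair. The
    disjoint pairs 0, 1 and 2, 3 then contradict \<open>compare\<close> for
    \<open>S = {0, 1}\<close>; their disjointness is where \<open>n \<ge> 4\<close> enters.\<close>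
  have "\<exists>i j k. i < n \<and> j < n \<and> i \<noteq> j \<and> P i j k \<and> k \<noteq> i \<and> k \<noteq> j"
  proof (rule ccontr)
    assume "\<not> ?thesis"
    then have in_pair: "k = i \<or> k = j" if "P i j k" "i < n" "j < n" "i \<noteq> j" for i j k
      using that by blast
    obtain k k' where "P 0 1 k" "P 2 3 k'" using ex[of 0 1] ex[of 2 3] n by auto
    moreover from this have "k \<in> {0, 1}" "k' \<notin> {0, 1}"
      using in_pair[of 0 1 k] in_pair[of 2 3 k'] n by auto
    ultimately show False using compare[of 0 1 k 2 3 k' "{0, 1}"] n by auto
  qed
  then obtain i j k where ijk: "i < n" "j < n" "i \<noteq> j" "P i j k" "k \<noteq> i" "k \<noteq> j" by blast
  have k: "k < n" using ijk by (simp add: P_def collapses_def)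
  \<comment> \<open>Neither \<open>i, j\<close> nor \<open>l, m\<close> meets \<open>{k}\<close>, so
    \<open>compare\<close> with \<open>S = {k}\<close> forces the coordinate selected for
    \<open>l, m\<close> to be \<open>k\<close>.\<close>
  have off: "P l m k" if lm: "l < n" "m < n" "l \<noteq> m" "l \<noteq> k" "m \<noteq> k" for l m
  proof -
    obtain q where q: "P l m q" using ex lm by blast
    then have "q = k" using compare[OF ijk(4) q, of "{k}"] ijk lm by auto
    with q show ?thesis by simp
  qed
  \<comment> \<open>A pair \<open>r, s\<close> disjoint from \<open>{k, m}\<close> selects
    \<open>k\<close> by \<open>off\<close>. Comparison over \<open>S = {k, m}\<close> puts the
    coordinate selected for \<open>k, m\<close> into \<open>{k, m}\<close>, where \<open>a\<close>
    is constant.\<close>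
  have on: "f a = {a ! k}" if a: "a \<in> tuples A n" "a ! k = a ! m" "m < n" "m \<noteq> k" for a m
  proof -
    obtain q where q: "P k m q" using ex k a by metis
    have "\<not> {..<n} - {k, m} \<subseteq> {r}" for r
    proof
      assume "{..<n} - {k, m} \<subseteq> {r}"
      then have "{..<n} \<subseteq> {k, m, r}" by auto
      then have "card {..<n} \<le> card {k, m, r}" by (intro card_mono) auto
      also have "\<dots> \<le> 3" by (auto simp: card_insert_if)
      finally show False using n by simp
    qed
    then obtain r s where rs: "r < n" "s < n" "r \<noteq> s" "r \<notin> {k, m}" "s \<notin> {k, m}"
      by (metis DiffD1 DiffD2 lessThan_iff singletonI subsetI)
    have "P r s k" using off rs by auto
    then have "q \<in> {k, m}" using compare[OF q, of r s k "{k, m}"] rs k a by auto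
    then have "a ! q = a ! k" using a by auto
    moreover have "f a = {a ! q}" using q a by (auto simp: P_def collapses_def)
    ultimately show ?thesis by simp
  qed
  have "f a = {a ! k}" if a: "a \<in> tuples A n" "\<not> distinct a" for a
  proof -
    obtain l m where lm: "l < n" "m < n" "l \<noteq> m" "a ! l = a ! m"
      using a by (auto simp: distinct_conv_nth tuples_def)
    show ?thesis
    proof (cases "l = k \<or> m = k")
      case True
      then show ?thesis using on[OF a(1)] lm by metis
    next
      case False
      then show ?thesis using off[of l m] lm a by (auto simp: P_def collapses_def)
    qed
  qed
  then show ?thesis using n k by (auto simp: semiprojection_def)
qed

section \<open>Semiprojections and majorities versus projections\<close>

text \<open>Turns an identity checked on tuples with a repeated entry into one valid everywhere. The
  semiprojection \<open>g\<close> is some projection, and a two-valued tuple singling out coordinate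
  \<open>i\<close> shows that it is the projection to \<open>i\<close>.\<close>

lemma semiprojection_trivial:
  assumes C: "multiclone A C" and xy: "x \<in> A" "y \<in> A" "x \<noteq> y"
    and triv: "\<And>h. h \<in> C \<Longrightarrow> semiprojection A h \<Longrightarrow> h \<in> projections A"
    and g: "(n, g) \<in> C" and n: "n \<ge> 3" and i: "i < n"
    and semi: "\<And>a. a \<in> tuples A n \<Longrightarrow> \<not> distinct a \<Longrightarrow> g a = {a ! i}"
    and a: "a \<in> tuples A n"
  shows "g a = {a ! i}"
proof -
  have "semiprojection A (n, g)" using n i semi by (auto simp: semiprojection_def)
  then have "(n, g) \<in> projections A" using triv g by blast
  then have "\<exists>k<n. \<forall>a\<in>tuples A n. g a = {a ! k}"
    using projection_mem_iff[OF _ g] C unfolding multiclone_def by blast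
  then obtain k where k: "k < n" "\<And>a. a \<in> tuples A n \<Longrightarrow> g a = {a ! k}" by blast
  define b where "b = map (\<lambda>l. if l = i then x else y) [0..<n]"
  have b: "b \<in> tuples A n" unfolding b_def by (rule map_upt_in_tuples) (use xy in auto)
  have "\<not> distinct b"
  proof
    assume "distinct b"
    then have "card (set b) = n" using distinct_card[of b] by (simp add: b_def)
    moreover have "card (set b) \<le> card {x, y}" by (intro card_mono) (auto simp: b_def)
    moreover have "card {x, y} \<le> 2" by (auto simp: card_insert_if)
    ultimately show False using n by simp
  qed
  then have "b ! k = b ! i" using semi[OF b] k(2)[OF b] by simp
  then have "k = i" using k(1) i xy by (auto simp: b_def split: if_splits)
  then show ?thesis using k(2) a by simp
qed

text \<open>Each of the three coordinates carries \<open>y\<close> in one of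
  \<open>[x, x, y]\<close>, \<open>[x, y, x]\<close>, \<open>[y, x, x]\<close>, where a majority has
  the value \<open>{x}\<close>.\<close>

lemma majority_not_projection:
  assumes "x \<in> A" "y \<in> A" "x \<noteq> y" and "majority A h"
  shows "h \<notin> projections A"
proof
  assume "h \<in> projections A"
  then obtain n i where h: "h = of_op A n (\<lambda>a. a ! i)" "i < n" by (auto simp: projections_def)
  with assms(4) have n: "n = 3" by (simp add: majority_def of_op_def)
  have "[x, x, y] ! i = x" "[x, y, x] ! i = x" "[y, x, x] ! i = x"
    using assms h(1) n by (auto simp: majority_def of_op_def tuples_three)
  moreover have "i = 0 \<or> i = 1 \<or> i = 2" using h(2) n by linarith
  ultimately show False using assms by (auto simp: numeral_2_eq_2)
qed

section \<open>Ternary multioperations\<close>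

definition minority :: "'a set \<Rightarrow> ('a list \<Rightarrow> 'a set) \<Rightarrow> bool" where
  "minority A f \<longleftrightarrow>
     (\<forall>x\<in>A. \<forall>y\<in>A. f [x, x, y] = {y} \<and> f [x, y, x] = {y} \<and> f [y, x, x] = {y})"

text \<open>Each of the three identifications yields either the repeated or the other value, which
  leaves eight patterns: one majority, one minority, three semiprojections and three of Pixley
  type.\<close>

lemma ternary_trichotomy:
  assumes C: "multiclone A C" and f: "(3, f) \<in> C"
    and col: "\<And>i j. i < j \<Longrightarrow> j < 3 \<Longrightarrow> \<exists>k. collapses A 3 f i j k"
  shows "semiprojection A (3, f) \<or> (\<exists>h\<in>C. majority A h) \<or> minority A f"
proof -
  have less3: "k = 0 \<or> k = 1 \<or> k = 2" if "k < 3" for k :: nat using that by linarith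
  obtain k1 k2 k3 where k: "collapses A 3 f 0 1 k1" "collapses A 3 f 0 2 k2" "collapses A 3 f 1 2 k3"
    using col[of 0 1] col[of 0 2] col[of 1 2] by auto
  have c1: "(\<forall>x\<in>A. \<forall>y\<in>A. f [x, x, y] = {x}) \<or> (\<forall>x\<in>A. \<forall>y\<in>A. f [x, x, y] = {y})"
    using k(1) less3[of k1] by (auto simp: collapses_def tuples_three)
  have c2: "(\<forall>x\<in>A. \<forall>y\<in>A. f [x, y, x] = {x}) \<or> (\<forall>x\<in>A. \<forall>y\<in>A. f [x, y, x] = {y})"
    using k(2) less3[of k2] by (auto simp: collapses_def tuples_three)
  have c3: "(\<forall>x\<in>A. \<forall>y\<in>A. f [y, x, x] = {x}) \<or> (\<forall>x\<in>A. \<forall>y\<in>A. f [y, x, x] = {y})"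
    using k(3) less3[of k3] by (auto simp: collapses_def tuples_three)
  have semi: "semiprojection A (3, f)"
    if "i < 3" "\<And>x y. x \<in> A \<Longrightarrow> y \<in> A \<Longrightarrow> f [x, x, y] = {[x, x, y] ! i}"
      "\<And>x y. x \<in> A \<Longrightarrow> y \<in> A \<Longrightarrow> f [x, y, x] = {[x, y, x] ! i}"
      "\<And>x y. x \<in> A \<Longrightarrow> y \<in> A \<Longrightarrow> f [y, x, x] = {[y, x, x] ! i}" for i
    unfolding semiprojection_def prod.case using that
    by (intro conjI exI[of _ i]) (auto simp: tuples_three)
  let ?e = "\<lambda>i. \<lambda>a\<in>tuples A 3. {a ! i}"
  let ?c = "\<lambda>g h k. \<lambda>a\<in>tuples A 3. \<Union>u\<in>g a. \<Union>v\<in>h a. \<Union>w\<in>k a. f [u, v, w]"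
  \<comment> \<open>One substitution for each Pixley type: \<open>f\<close> goes into the place
    outside the single pair whose equality yields the repeated value.\<close>
  have m1: "(3, ?c (?e 0) (?e 1) f) \<in> C"
    by (rule multiclone_comp3[OF C f multiclone_projection[OF C] multiclone_projection[OF C] f]) simp_all
  have m2: "(3, ?c (?e 0) f (?e 2)) \<in> C"
    by (rule multiclone_comp3[OF C f multiclone_projection[OF C] f multiclone_projection[OF C]]) simp_all
  have m3: "(3, ?c f (?e 1) (?e 2)) \<in> C"
    by (rule multiclone_comp3[OF C f f multiclone_projection[OF C] multiclone_projection[OF C]]) simp_all
  have t3: "[x, y, z] \<in> tuples A 3" if "x \<in> A" "y \<in> A" "z \<in> A" for x y z
    using that by (auto simp: tuples_three)
  from c1 c2 c3 show ?thesis
  proof (elim disjE, goal_cases)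
    case 1
    then have "majority A (3, f)" by (simp add: majority_def)
    with f show ?thesis by blast
  next
    case 2 then show ?thesis using semi[of 0] by simp
  next
    case 3 then show ?thesis using semi[of 1] by simp
  next
    case 4
    then have "majority A (3, ?c (?e 0) (?e 1) f)" by (simp add: majority_def t3)
    with m1 show ?thesis by blast
  next
    case 5 then show ?thesis using semi[of 2] by simp
  next
    case 6
    then have "majority A (3, ?c (?e 0) f (?e 2))" by (simp add: majority_def t3)
    with m2 show ?thesis by blast
  next
    case 7
    then have "majority A (3, ?c f (?e 1) (?e 2))" by (simp add: majority_def t3)
    with m3 show ?thesis by blast
  next
    case 8 then show ?thesis by (simp add: minority_def)
  qed
qed

section \<open>From a minority to a Boolean group\<close>

text \<open>All identities come the same way: the minority law evaluates a term on tuples with a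
  repeated entry, and \<open>semiprojection_trivial\<close> extends the result to all tuples. The
  neutral element may be any point of \<open>A\<close>; \<open>x0\<close> is taken.\<close>

lemma boolean_group_if_minority:
  assumes C: "multiclone A C" and xy: "x0 \<in> A" "y0 \<in> A" "x0 \<noteq> y0"
    and triv: "\<And>h. h \<in> C \<Longrightarrow> semiprojection A h \<Longrightarrow> h \<in> projections A"
    and f: "(3, f) \<in> C" and minor: "minority A f"
  shows "\<exists>G :: 'a monoid. carrier G = A \<and> boolean_group G \<and>
    of_op A 3 (\<lambda>a. a ! 0 \<otimes>\<^bsub>G\<^esub> a ! 1 \<otimes>\<^bsub>G\<^esub> a ! 2) = (3, f)"
proof -
  have fE: "f \<in> tuples A 3 \<rightarrow>\<^sub>E Pow A" using C f by (auto simp: multiclone_def multiops_def)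
  have t3: "[x, y, z] \<in> tuples A 3" if "x \<in> A" "y \<in> A" "z \<in> A" for x y z
    using that by (auto simp: tuples_three)
  have fA: "f [x, y, z] \<subseteq> A" if "x \<in> A" "y \<in> A" "z \<in> A" for x y z
    using fE t3[OF that] by auto
  have mf: "f [x, x, y] = {y}" "f [x, y, x] = {y}" "f [y, x, x] = {y}"
    if "x \<in> A" "y \<in> A" for x y using minor that by (auto simp: minority_def)
  have st: "g a = {a ! i}"
    if "(n, g) \<in> C" "n \<ge> 3" "i < n" "a \<in> tuples A n"
      "\<And>a. a \<in> tuples A n \<Longrightarrow> \<not> distinct a \<Longrightarrow> g a = {a ! i}" for n g i a
    using semiprojection_trivial[OF C xy _ that(1-3) that(5) that(4)] triv by blast
  \<comment> \<open>Used with \<open>(p, q, i)\<close> equal to \<open>(0, 1, 2)\<close>,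
    \<open>(0, 2, 1)\<close> and \<open>(1, 0, 2)\<close>, for the involution law and two
    transpositions. Unions remain because \<open>f\<close> is not yet known to be
    single-valued.\<close>
  have semi3: "(\<Union>w\<in>f [x, y, z]. f [[x, y, z] ! p, [x, y, z] ! q, w]) = {[x, y, z] ! i}"
    if "p < 3" "q < 3" "i < 3" "x \<in> A" "y \<in> A" "z \<in> A"
      "\<And>x y z. x \<in> A \<Longrightarrow> y \<in> A \<Longrightarrow> z \<in> A \<Longrightarrow> x = y \<or> x = z \<or> y = z \<Longrightarrow>
        (\<Union>w\<in>f [x, y, z]. f [[x, y, z] ! p, [x, y, z] ! q, w]) = {[x, y, z] ! i}"
    for p q i x y z
  proof -
    have "(\<lambda>a\<in>tuples A 3. \<Union>w\<in>f a. f [a ! p, a ! q, w]) [x, y, z] = {[x, y, z] ! i}"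
    proof (rule st[OF multiclone_comp3_third[OF C f that(1,2) f] _ that(3) t3[OF that(4-6)]])
      fix a assume a: "a \<in> tuples A 3" "\<not> distinct a"
      then obtain x y z where "a = [x, y, z]" "x \<in> A" "y \<in> A" "z \<in> A" "x = y \<or> x = z \<or> y = z"
        by (auto simp: tuples_three)
      then show "(\<lambda>a\<in>tuples A 3. \<Union>w\<in>f a. f [a ! p, a ! q, w]) a = {a ! i}"
        using that(7)[of x y z] t3 by simp
    qed auto
    then show ?thesis using t3[OF that(4-6)] by simp
  qed
  have inv: "(\<Union>w\<in>f [x, y, z]. f [x, y, w]) = {z}" if "x \<in> A" "y \<in> A" "z \<in> A" for x y z
  proof -
    have "(\<Union>w\<in>f [x, y, z]. f [[x, y, z] ! 0, [x, y, z] ! 1, w]) = {[x, y, z] ! 2}"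
      by (rule semi3) (use that mf in auto)
    then show ?thesis by simp
  qed
  \<comment> \<open>An empty value would make the union in \<open>inv\<close> empty.\<close>
  have ne: "f [x, y, z] \<noteq> {}" if "x \<in> A" "y \<in> A" "z \<in> A" for x y z
    using inv[OF that] by auto
  have invol: "f [x, y, u] = {z}" if "x \<in> A" "y \<in> A" "z \<in> A" "u \<in> f [x, y, z]" for x y z u
  proof -
    have "u \<in> A" using fA that by blast
    moreover have "f [x, y, u] \<subseteq> {z}" using inv[OF that(1-3)] that(4) by blast
    ultimately show ?thesis using ne[of x y u] that by (simp add: subset_singleton_iff)
  qed
  have "\<exists>u\<in>A. f [x, y, z] = {u}" if "x \<in> A" "y \<in> A" "z \<in> A" for x y z
  proof -
    have "f [x, y, z] \<noteq> {}" by (rule ne[OF that])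
    then obtain u where u: "u \<in> f [x, y, z]" by blast
    then have uA: "u \<in> A" using fA that by blast
    \<comment> \<open>Membership is symmetric in \<open>u\<close> and \<open>z\<close>, so
      \<open>invol\<close> with the two exchanged gives \<open>f [x, y, z] = {u}\<close>.\<close>
    have "z \<in> f [x, y, u]" using invol[OF that u] by simp
    then show ?thesis using invol[of x y u z] that uA by blast
  qed
  then have elem: "the_elem (f [x, y, z]) \<in> A" "f [x, y, z] = {the_elem (f [x, y, z])}"
    if "x \<in> A" "y \<in> A" "z \<in> A" for x y z
    using that by force+
  define g where "g x y z = the_elem (f [x, y, z])" for x y z
  have gA: "g x y z \<in> A" and g: "f [x, y, z] = {g x y z}"
    if "x \<in> A" "y \<in> A" "z \<in> A" for x y z
    unfolding g_def using elem[OF that] by blast+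
  have mg: "g x x y = y" "g x y x = y" "g y x x = y" if "x \<in> A" "y \<in> A" for x y
    using mf[OF that] g that by auto
  have inv_g: "g x y (g x y z) = z" if "x \<in> A" "y \<in> A" "z \<in> A" for x y z
    using inv[OF that] g gA that by simp
  have swap23_aux: "g x z (g x y z) = y" if "x \<in> A" "y \<in> A" "z \<in> A" for x y z
  proof -
    have "(\<Union>w\<in>f [x, y, z]. f [[x, y, z] ! 0, [x, y, z] ! 2, w]) = {[x, y, z] ! 1}"
      by (rule semi3) (use that mf in auto)
    then show ?thesis using that g gA by simp
  qed
  \<comment> \<open>Applying the involution \<open>g x z\<close> to both sides of
    \<open>swap23_aux\<close> isolates \<open>g x y z\<close>; \<open>swap12\<close> is obtained
    alike from \<open>g y x\<close>.\<close>
  have swap23: "g x y z = g x z y" if "x \<in> A" "y \<in> A" "z \<in> A" for x y z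
    using swap23_aux[OF that] inv_g[of x z "g x y z"] gA that by simp
  have swap12_aux: "g y x (g x y z) = z" if "x \<in> A" "y \<in> A" "z \<in> A" for x y z
  proof -
    have "(\<Union>w\<in>f [x, y, z]. f [[x, y, z] ! 1, [x, y, z] ! 0, w]) = {[x, y, z] ! 2}"
      by (rule semi3) (use that mf in auto)
    then show ?thesis using that g gA by simp
  qed
  have swap12: "g x y z = g y x z" if "x \<in> A" "y \<in> A" "z \<in> A" for x y z
    using swap12_aux[OF that] inv_g[of y x "g x y z"] gA that by simp
  have swap13: "g x y z = g z y x" if "x \<in> A" "y \<in> A" "z \<in> A" for x y z
    using that swap12[of x y z] swap23[of y x z] swap12[of y z x] by simp
  \<comment> \<open>The law \<open>assoc\<close> with \<open>g x y\<close> applied to both sides, a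
    form in which the 4-ary term is a semiprojection on \<open>z\<close>.\<close>
  have assoc4: "g x y (g x u (g y u z)) = z" if xs: "x \<in> A" "y \<in> A" "z \<in> A" "u \<in> A" for x y z u
  proof -
    \<comment> \<open>With variables ordered \<open>x, y, z, u\<close>, the indices
      \<open>[1, 3, 2]\<close> give \<open>f(y, u, z)\<close>. Then \<open>h2\<close> and
      \<open>h3\<close> wrap it in \<open>f(x, u, _)\<close> and \<open>f(x, y, _)\<close>.\<close>
    define h1 where "h1 = (\<lambda>a\<in>tuples A 4. f (map (\<lambda>k. a ! ([1, 3, 2] ! k)) [0..<3]))"
    define h2 where "h2 = (\<lambda>a\<in>tuples A 4. \<Union>w\<in>h1 a. f [a ! 0, a ! 3, w])"
    define h3 where "h3 = (\<lambda>a\<in>tuples A 4. \<Union>w\<in>h2 a. f [a ! 0, a ! 1, w])"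
    have h1: "(4, h1) \<in> C" unfolding h1_def
    proof (rule multiclone_subst_vars[OF C f])
      fix k :: nat assume "k < 3"
      then have "k = 0 \<or> k = 1 \<or> k = 2" by linarith
      then show "[1, 3, 2] ! k < (4 :: nat)" by auto
    qed
    have h2: "(4, h2) \<in> C" unfolding h2_def by (rule multiclone_comp3_third[OF C f _ _ h1]) auto
    have h3: "(4, h3) \<in> C" unfolding h3_def by (rule multiclone_comp3_third[OF C f _ _ h2]) auto
    have t4: "[x, y, z, u] \<in> tuples A 4" if "x \<in> A" "y \<in> A" "z \<in> A" "u \<in> A" for x y z u
      using that by (auto simp: tuples_four)
    have h3_eq: "h3 [x, y, z, u] = {g x y (g x u (g y u z))}"
      if "x \<in> A" "y \<in> A" "z \<in> A" "u \<in> A" for x y z u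
      using that t4[OF that] g gA
      by (simp add: h1_def h2_def h3_def upt_rec[of 0 3] upt_rec[of 1 3] upt_rec[of 2 3]
          numeral_2_eq_2 numeral_3_eq_3)
    have "h3 [x, y, z, u] = {[x, y, z, u] ! 2}"
    proof (rule st[OF h3 _ _ t4[OF xs]])
      fix a assume a: "a \<in> tuples A 4" "\<not> distinct a"
      then obtain x y z u where axyzu: "a = [x, y, z, u]" and xs: "x \<in> A" "y \<in> A" "z \<in> A" "u \<in> A"
        and eq: "x = y \<or> x = z \<or> x = u \<or> y = z \<or> y = u \<or> z = u"
        by (auto simp: tuples_four)
      have "g x y (g x u (g y u z)) = z"
        using eq
      proof (elim disjE)
        assume "x = y" then show ?thesis using xs inv_g mg by simp
      next
        assume "x = z" then show ?thesis using xs inv_g mg swap13[of y u x] by simp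
      next
        assume "x = u" then show ?thesis using xs inv_g mg gA swap12[of y x z] by simp
      next
        assume "y = z" then show ?thesis using xs mg by simp
      next
        assume "y = u" then show ?thesis using xs mg inv_g by simp
      next
        assume "z = u" then show ?thesis using xs mg inv_g swap23[of x z y] by simp
      qed
      then show "h3 a = {a ! 2}" using h3_eq[OF xs] axyzu by simp
    qed auto
    then show ?thesis using h3_eq[OF xs] by simp
  qed
  have assoc: "g x u (g y u z) = g x y z" if "x \<in> A" "y \<in> A" "z \<in> A" "u \<in> A" for x y z u
    using assoc4[OF that] inv_g[of x y "g x u (g y u z)"] gA that by simp
  define G :: "'a monoid" where "G = \<lparr>carrier = A, mult = (\<lambda>x y. g x x0 y), one = x0\<rparr>"
  have G_simps: "carrier G = A" "\<one>\<^bsub>G\<^esub> = x0" "x \<otimes>\<^bsub>G\<^esub> y = g x x0 y" for x y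
    by (simp_all add: G_def)
  \<comment> \<open>Moving the inner sum to the third place by symmetry lets \<open>assoc\<close>
    cancel \<open>x0\<close>. The result gives associativity and also identifies \<open>f\<close>
    with the threefold sum.\<close>
  have sum3: "g (g x x0 y) x0 z = g x y z" if "x \<in> A" "y \<in> A" "z \<in> A" for x y z
  proof -
    have "g (g x x0 y) x0 z = g z x0 (g x x0 y)"
      using that xy gA by (intro swap13) auto
    also have "\<dots> = g z x y" using assoc that xy by simp
    also have "\<dots> = g x y z" using that swap12[of z x y] swap23[of x z y] by simp
    finally show ?thesis .
  qed
  have "group G"
  proof (rule groupI, unfold G_simps)
    fix x y z assume "x \<in> A" "y \<in> A" "z \<in> A"
    then show "g (g x x0 y) x0 z = g x x0 (g y x0 z)" using sum3 assoc xy by simp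
  next
    fix x assume "x \<in> A"
    \<comment> \<open>The inverse of \<open>x\<close> is \<open>x\<close> itself, since
      \<open>g x x0 x = x0\<close>.\<close>
    then show "\<exists>y\<in>A. g y x0 x = x0" using mg xy by blast
  qed (use xy gA mg in auto)
  then have "boolean_group G" using mg xy by (simp add: boolean_group_def G_simps)
  moreover have "of_op A 3 (\<lambda>a. a ! 0 \<otimes>\<^bsub>G\<^esub> a ! 1 \<otimes>\<^bsub>G\<^esub> a ! 2) = (3, f)"
  proof -
    have "(\<lambda>a\<in>tuples A 3. {a ! 0 \<otimes>\<^bsub>G\<^esub> a ! 1 \<otimes>\<^bsub>G\<^esub> a ! 2}) = f"
    proof
      fix a
      show "(\<lambda>a\<in>tuples A 3. {a ! 0 \<otimes>\<^bsub>G\<^esub> a ! 1 \<otimes>\<^bsub>G\<^esub> a ! 2}) a = f a"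
      proof (cases "a \<in> tuples A 3")
        case True
        then obtain x y z where "a = [x, y, z]" "x \<in> A" "y \<in> A" "z \<in> A"
          by (auto simp: tuples_three)
        then show ?thesis using True sum3 g by (simp add: G_simps)
      next
        case False
        then show ?thesis using PiE_arb[OF fE] by simp
      qed
    qed
    then show ?thesis by (simp add: of_op_def)
  qed
  ultimately show ?thesis using G_simps(1) by blast
qed

section \<open>Low arities and the case distinction\<close>

text \<open>The diagonal of \<open>f\<close> is a unary member of \<open>C\<close>, and the only
  unary projection is the identity.\<close>

lemma binary_idempotent_if_unary_trivial:
  assumes C: "multiclone A C" and f: "(2, f) \<in> C"
    and unary: "\<And>g. (1, g) \<in> C \<Longrightarrow> (1, g) \<in> projections A"
  shows "idempotent_multiop A (2, f)"
proof -
  define g where "g = (\<lambda>b\<in>tuples A 1. f (map (\<lambda>k. b ! 0) [0..<2]))"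
  have gC: "(1, g) \<in> C" unfolding g_def by (rule multiclone_subst_vars[OF C f]) auto
  then have g: "g a = {a ! 0}" if "a \<in> tuples A 1" for a
    using unary projection_mem_iff[OF _ gC] C that unfolding multiclone_def
    by (metis less_one)
  have "f (replicate 2 x) = {x}" if "x \<in> A" for x
  proof -
    have "[x] \<in> tuples A 1" using that by (simp add: tuples_def)
    moreover have "map (\<lambda>k. [x] ! 0) [0..<2] = replicate 2 x" by (simp add: map_replicate_const)
    ultimately show ?thesis using g[of "[x]"] by (simp add: g_def)
  qed
  then show ?thesis by (simp add: idempotent_multiop_def)
qed

theorem theorem1:
  fixes A :: "'a set" and C :: "'a multiop set"
  assumes "infinite A \<or> card A \<ge> 2"
    and "multiclone A C"
    and "C \<noteq> projections A"
  shows "(\<exists>f. (1, f) \<in> C - projections A)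
    \<or> (\<exists>f. (2, f) \<in> C - projections A \<and> idempotent_multiop A (2, f))
    \<or> (\<exists>h \<in> C - projections A. majority A h)
    \<or> (\<exists>h \<in> C - projections A. semiprojection A h)
    \<or> (\<exists>G :: 'a monoid. carrier G = A \<and> boolean_group G \<and>
         of_op A 3 (\<lambda>a. a ! 0 \<otimes>\<^bsub>G\<^esub> a ! 1 \<otimes>\<^bsub>G\<^esub> a ! 2) \<in> C - projections A)"
proof (rule ccontr)
  assume neg: "\<not> ?thesis"
  note C = assms(2)
  obtain x y where xy: "x \<in> A" "y \<in> A" "x \<noteq> y"
  proof -
    have "\<not> A \<subseteq> {x}" for x
    proof
      assume sub: "A \<subseteq> {x}"
      then have "finite A" by (rule finite_subset) simp
      moreover have "card A \<le> card {x}" using sub by (intro card_mono) auto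
      ultimately show False using assms(1) by simp
    qed
    then show ?thesis using that by blast
  qed
  have unary: "(1, g) \<in> projections A" if "(1, g) \<in> C" for g using neg that by blast
  have binary: "(2, g) \<in> projections A" if "(2, g) \<in> C" for g
    using neg that binary_idempotent_if_unary_trivial[OF C that unary] by blast
  have semi: "h \<in> projections A" if "h \<in> C" "semiprojection A h" for h using neg that by blast
  \<comment> \<open>A majority in \<open>C\<close> would lie outside the projections and so realize
    an excluded alternative.\<close>
  have maj: "\<not> majority A h" if "h \<in> C" for h
    using neg that majority_not_projection[OF xy] by blast
  define n where "n = (LEAST n. \<exists>f. (n, f) \<in> C - projections A)"
  have "C - projections A \<noteq> {}" using assms(2,3) by (auto simp: multiclone_def)
  then have "\<exists>n f. (n, f) \<in> C - projections A" by (metis ex_in_conv surj_pair)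
  then have "\<exists>f. (n, f) \<in> C - projections A" unfolding n_def by (rule LeastI_ex)
  then obtain f where f: "(n, f) \<in> C" "(n, f) \<notin> projections A" by blast
  have low: "(m, g) \<in> projections A" if "(m, g) \<in> C" "m < n" for m g
    using that not_less_Least unfolding n_def by blast
  have "n \<ge> 1" using f C by (auto simp: multiclone_def multiops_def)
  moreover have "n \<noteq> 1" "n \<noteq> 2" using f unary binary by auto
  ultimately have n: "n \<ge> 3" by simp
  \<comment> \<open>Minimality of \<open>n\<close> makes every member of arity \<open>n - 1\<close>
    a projection.\<close>
  have col: "\<exists>k. collapses A n f i j k" if "i < j" "j < n" for i j
    by (rule collapses_if_lower_arity_projections[OF C f(1) _ that]) (use low n in auto)
  show False
  proof (cases "n = 3")
    case True
    have f3: "(3, f) \<in> C" "(3, f) \<notin> projections A" using f True by auto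
    have "semiprojection A (3, f) \<or> (\<exists>h\<in>C. majority A h) \<or> minority A f"
      by (rule ternary_trichotomy[OF C f3(1)]) (use col True in auto)
    then have minor: "minority A f" using semi maj f3 by blast
    obtain G :: "'a monoid" where "carrier G = A" "boolean_group G"
      "of_op A 3 (\<lambda>a. a ! 0 \<otimes>\<^bsub>G\<^esub> a ! 1 \<otimes>\<^bsub>G\<^esub> a ! 2) = (3, f)"
      using boolean_group_if_minority[OF C xy semi f3(1) minor] by blast
    then have "of_op A 3 (\<lambda>a. a ! 0 \<otimes>\<^bsub>G\<^esub> a ! 1 \<otimes>\<^bsub>G\<^esub> a ! 2) \<in> C - projections A"
      using f3 by simp
    then show False using neg \<open>carrier G = A\<close> \<open>boolean_group G\<close> by blast
  next
    case False
    then have "semiprojection A (n, f)"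
      using semiprojection_if_collapses[OF xy _ col] n by simp
    then show False using semi f by blast
  qed
qed

end
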